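(* Let $G$ be a finite simple oriented graph with pebbling assignment $(S_G)$. If the underlying undirected graph of $G$ is (isomorphic to) an induced subgraph of the underlying undirected graph of $[S_G]$, then there exist an oriented graph $H$ and a pebbling assignment $(S_H)$ on $H$ such that $G$ is an oriented subgraph of $H$, $(S_G)$ is the restriction of $(S_H)$ to the vertices of $G$, and $H\cong [S_H]$ as undirected graphs (i.e. their underlying undirected graphs are isomorphic).
   Context: An oriented graph is a directed graph with no loops, no multiple edges and no pair of opposite edges. A pebbling assignment assigns a nonnegative integer number of pebbles to each vertex. A pebbling move along an edge $(v,w)$ (allowed when $v$ has at least two pebbles) removes two pebbles from $v$ and adds one pebble to $w$. The assignment graph $[S_G]$ is the directed graph whose vertices are all assignments obtainable from $(S_G)$ by finite sequences of pebbling moves (including $(S_G)$ itself), with a directed edge from $A$ to $B$ whenever $B$ is obtained from $A$ by a single pebbling move. *)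

theory Defs
  imports "Graph_Theory.Graph_Theory"
begin

(* Arcs are ordered pairs, so multiple arcs are excluded by the type; finiteness is stated
   separately. *)
locale oriented_graph = pair_loopfree_digraph +
  assumes no_opposite_arcs: "(u, v) \<in> parcs G \<Longrightarrow> (v, u) \<notin> parcs G"

(* A pebbling assignment on G is a function 'a \<Rightarrow> nat of which only the values on pverts G
   matter: no move changes a value outside pverts G, so distinct reachable assignments
   always differ on pverts G. *)
definition pebbling_move :: "'a pair_pre_digraph \<Rightarrow> ('a \<Rightarrow> nat) \<Rightarrow> ('a \<Rightarrow> nat) \<Rightarrow> bool" where
  "pebbling_move G A B \<longleftrightarrow>
     (\<exists>v w. (v, w) \<in> parcs G \<and> 2 \<le> A v \<and> B = A(v := A v - 2, w := A w + 1))"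

definition assignment_graph ::
    "'a pair_pre_digraph \<Rightarrow> ('a \<Rightarrow> nat) \<Rightarrow> ('a \<Rightarrow> nat) pair_pre_digraph" where
  "assignment_graph G S =
     \<lparr> pverts = {A. (pebbling_move G)\<^sup>*\<^sup>* S A},
       parcs = {(A, B). (pebbling_move G)\<^sup>*\<^sup>* S A \<and> pebbling_move G A B} \<rparr>"

definition relabel :: "('a \<Rightarrow> 'b) \<Rightarrow> 'a pair_pre_digraph \<Rightarrow> 'b pair_pre_digraph" where
  "relabel f G = \<lparr> pverts = f ` pverts G, parcs = map_prod f f ` parcs G \<rparr>"

end

theory Submission
  imports Defs
begin

text \<open>
  Let \<open>W\<close> be the assignment graph of \<open>G\<close> and let \<open>f\<close> embed the underlying graph of \<open>G\<close> in that of
  \<open>W\<close>. The graph \<open>H\<close> is \<open>W\<close> with the image of \<open>f\<close> replaced by \<open>G\<close>: edges inside the image get the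
  orientation of \<open>G\<close>, edges between the image and the rest point towards the image, and edges
  outside the image keep the orientation of \<open>W\<close>. The new vertices carry no pebbles. Since no arc
  leaves \<open>G\<close>, they never receive any, so the assignment graph of \<open>H\<close> is a copy of \<open>W\<close>, whose
  underlying graph is that of \<open>H\<close>.
\<close>

section \<open>Relabelling, symmetrisation and isomorphism of digraphs on pairs\<close>

lemma pverts_relabel [simp]: "pverts (relabel f P) = f ` pverts P"
  and parcs_relabel [simp]: "parcs (relabel f P) = map_prod f f ` parcs P"
  by (simp_all add: relabel_def)

lemma parcs_mk_symmetric_with_proj: "parcs (mk_symmetric (with_proj P)) = parcs P \<union> (parcs P)\<inverse>"
  by (force simp: parcs_mk_symmetric)

lemma mk_symmetric_relabel:
  "mk_symmetric (with_proj (relabel f P)) = relabel f (mk_symmetric (with_proj P))"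
proof (rule pair_pre_digraph.equality)
  have "map_prod f f ` (parcs P)\<inverse> = (map_prod f f ` parcs P)\<inverse>"
    by force
  then show "parcs (mk_symmetric (with_proj (relabel f P))) =
      parcs (relabel f (mk_symmetric (with_proj P)))"
    by (simp add: parcs_mk_symmetric_with_proj image_Un)
qed simp_all

lemma pair_wf_digraph_mk_symmetric:
  "pair_wf_digraph P \<Longrightarrow> pair_wf_digraph (mk_symmetric (with_proj P))"
  by (auto simp: pair_wf_digraph_def parcs_mk_symmetric_with_proj)

lemma wf_digraph_with_proj: "pair_wf_digraph P \<Longrightarrow> wf_digraph (with_proj P)"
  by (auto simp: pair_wf_digraph_def wf_digraph_def)

lemma pair_wf_digraph_relabel: "pair_wf_digraph P \<Longrightarrow> pair_wf_digraph (relabel f P)"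
  by (auto simp: pair_wf_digraph_def)

lemma digraph_iso_relabel:
  assumes wf: "pair_wf_digraph P" and inj: "inj_on f (pverts P)"
  shows "digraph_iso (with_proj P) (with_proj (relabel f P))"
proof -
  \<comment> \<open>Keeping \<open>fst\<close> and \<open>snd\<close> as tail and head makes the
    image graph literally a \<open>with_proj\<close> graph.\<close>
  let ?h = "\<lparr>iso_verts = f, iso_arcs = map_prod f f, iso_head = snd, iso_tail = fst\<rparr>"
  have "parcs P \<subseteq> pverts P \<times> pverts P"
    using wf by (auto simp: pair_wf_digraph_def)
  with inj have "inj_on (map_prod f f) (parcs P)"
    using map_prod_inj_on inj_on_subset by blast
  then have "pre_digraph.digraph_isomorphism (with_proj P) ?h"
    using inj wf_digraph_with_proj[OF wf] by (simp add: pre_digraph.digraph_isomorphism_def)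
  moreover have "with_proj (relabel f P) = app_iso ?h (with_proj P)"
    by (simp add: with_proj_def app_iso_def)
  ultimately show ?thesis
    unfolding digraph_iso_def by blast
qed

text \<open>An isomorphism carries its own arc map, tail and head. Since \<open>K\<close> is
  compatible with \<open>with_proj Q\<close>, its tail and head are the projections, which forces
  the arc map to be the one induced by the vertex map.\<close>

lemma digraph_iso_induced_subgraphE:
  assumes "digraph_iso (with_proj P) K" and "induced_subgraph K (with_proj Q)"
  obtains f where "inj_on f (pverts P)" and "f ` pverts P \<subseteq> pverts Q"
    and "map_prod f f ` parcs P = {e \<in> parcs Q. fst e \<in> f ` pverts P \<and> snd e \<in> f ` pverts P}"
proof -
  from assms(1) obtain h where h: "pre_digraph.digraph_isomorphism (with_proj P) h"
    and K: "K = app_iso h (with_proj P)"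
    unfolding digraph_iso_def by blast
  let ?f = "iso_verts h"
  have ends: "iso_tail h = fst" "iso_head h = snd"
    using assms(2) by (auto simp: K induced_subgraph_def subgraph_def compatible_def)
  have "iso_arcs h a = map_prod ?f ?f a" if "a \<in> parcs P" for a
    using h that by (intro prod_eqI) (auto simp: pre_digraph.digraph_isomorphism_def ends)
  then have "map_prod ?f ?f ` parcs P = arcs K"
    by (simp add: K)
  also have "\<dots> = {e \<in> parcs Q. fst e \<in> ?f ` pverts P \<and> snd e \<in> ?f ` pverts P}"
    using assms(2) by (auto simp: induced_subgraph_def K)
  finally show thesis
    using h assms(2)
    by (intro that) (auto simp: pre_digraph.digraph_isomorphism_def induced_subgraph_def subgraph_def K)
qed

section \<open>Finiteness and orientation of assignment graphs\<close>

lemma pverts_assignment_graph: "pverts (assignment_graph G S) = {A. (pebbling_move G)\<^sup>*\<^sup>* S A}"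
  and parcs_assignment_graph:
    "parcs (assignment_graph G S) = {(A, B). (pebbling_move G)\<^sup>*\<^sup>* S A \<and> pebbling_move G A B}"
  by (simp_all add: assignment_graph_def)

lemma pair_wf_digraph_assignment_graph: "pair_wf_digraph (assignment_graph G S)"
  by (auto simp: pair_wf_digraph_def pverts_assignment_graph parcs_assignment_graph)

text \<open>Without loops the two ends of a move differ, so two pebbles vanish at one vertex and one
  appears at another. This strict decrease of the total drives the next two results.\<close>

lemma pebbling_move_sum:
  assumes "pair_loopfree_digraph G" and "finite (pverts G)" and "pebbling_move G A B"
  shows "sum A (pverts G) = Suc (sum B (pverts G))"
proof -
  interpret pair_loopfree_digraph G by fact
  from assms(3) obtain v w where vw: "(v, w) \<in> parcs G" and "2 \<le> A v"
    and B: "B = A(v := A v - 2, w := A w + 1)"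
    by (auto simp: pebbling_move_def)
  then have *: "v \<in> pverts G" "w \<in> pverts G - {v}"
    using pair_no_loops[OF vw] by (auto dest: wellformed')
  have "sum X (pverts G) = X v + (X w + sum X (pverts G - {v} - {w}))" for X :: "'a \<Rightarrow> nat"
    using * assms(2) by (simp add: sum.remove)
  moreover have "sum B (pverts G - {v} - {w}) = sum A (pverts G - {v} - {w})"
    by (rule sum.cong) (auto simp: B)
  ultimately show ?thesis
    using * \<open>2 \<le> A v\<close> by (auto simp: B)
qed

text \<open>The initial total bounds every value of a reachable assignment on the vertices, and off
  the vertices nothing ever changes.\<close>

lemma finite_assignment_graph:
  assumes "pair_loopfree_digraph G" and "finite (pverts G)"
  shows "finite (pverts (assignment_graph G S))"
proof (rule finite_subset)
  interpret pair_loopfree_digraph G by fact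
  \<comment> \<open>Functions in \<open>PiE\<close> are \<open>undefined\<close> off the vertex set;
    \<open>?extend\<close> puts the values of \<open>S\<close> back there.\<close>
  let ?extend = "\<lambda>B v. if v \<in> pverts G then B v else S v"
  let ?F = "PiE (pverts G) (\<lambda>_. {..sum S (pverts G)})"
  show "finite (?extend ` ?F)"
    using assms(2) by (intro finite_imageI finite_PiE) auto
  show "pverts (assignment_graph G S) \<subseteq> ?extend ` ?F"
  proof
    fix A assume "A \<in> pverts (assignment_graph G S)"
    then have "(pebbling_move G)\<^sup>*\<^sup>* S A" by (simp add: pverts_assignment_graph)
    then have A: "sum A (pverts G) \<le> sum S (pverts G) \<and> (\<forall>v. v \<notin> pverts G \<longrightarrow> A v = S v)"
    proof induction
      case (step A B)
      then show ?case
        using pebbling_move_sum[OF assms step.hyps(2)]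
        by (auto simp: pebbling_move_def dest: wellformed')
    qed simp
    have "A v \<le> sum S (pverts G)" if "v \<in> pverts G" for v
      using member_le_sum[of v "pverts G" A] that assms(2) A by force
    then have "restrict A (pverts G) \<in> ?F" by auto
    moreover have "A = ?extend (restrict A (pverts G))"
      using A by auto
    ultimately show "A \<in> ?extend ` ?F" by blast
  qed
qed

text \<open>A loop or a pair of opposite arcs would make the total strictly smaller than
  itself.\<close>

lemma oriented_graph_assignment_graph:
  assumes "pair_loopfree_digraph G" and "finite (pverts G)"
  shows "oriented_graph (assignment_graph G S)"
proof -
  interpret pair_wf_digraph "assignment_graph G S"
    by (rule pair_wf_digraph_assignment_graph)
  show ?thesis
    by unfold_locales (auto simp: parcs_assignment_graph dest!: pebbling_move_sum[OF assms])
qed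

text \<open>A move needs two pebbles at its tail, so it cannot start at an empty new vertex; by
  \<open>H\<close>, a move from an old vertex follows an arc of \<open>G\<close> and leaves the new
  vertices empty.\<close>

lemma assignment_graph_extend_zero:
  fixes G :: "'a pair_pre_digraph" and H :: "('a + 'b) pair_pre_digraph"
  assumes H: "\<And>v y. (Inl v, y) \<in> parcs H \<longleftrightarrow> (\<exists>w. y = Inl w \<and> (v, w) \<in> parcs G)"
  shows "assignment_graph H (case_sum S (\<lambda>_. 0)) =
    relabel (\<lambda>A. case_sum A (\<lambda>_. 0)) (assignment_graph G S)"
proof -
  let ?c = "\<lambda>A :: 'a \<Rightarrow> nat. case_sum A (\<lambda>_ :: 'b. 0 :: nat)"
  have upd: "(?c A)(Inl v := x, Inl w := y) = ?c (A(v := x, w := y))" for A v w x y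
    by (auto simp: fun_eq_iff split: sum.splits)
  have move: "pebbling_move H (?c A) B \<longleftrightarrow> (\<exists>A'. B = ?c A' \<and> pebbling_move G A A')" for A B
  proof
    assume "pebbling_move H (?c A) B"
    then obtain x y where xy: "(x, y) \<in> parcs H" "2 \<le> ?c A x"
      "B = (?c A)(x := ?c A x - 2, y := ?c A y + 1)"
      by (auto simp: pebbling_move_def)
    from xy(2) obtain v where x: "x = Inl v" by (cases x) auto
    with xy H obtain w where "y = Inl w" "(v, w) \<in> parcs G" by auto
    with xy x show "\<exists>A'. B = ?c A' \<and> pebbling_move G A A'"
      by (auto simp: pebbling_move_def upd)
  next
    assume "\<exists>A'. B = ?c A' \<and> pebbling_move G A A'"
    then obtain v w where "(v, w) \<in> parcs G" "2 \<le> A v" "B = ?c (A(v := A v - 2, w := A w + 1))"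
      by (auto simp: pebbling_move_def)
    then show "pebbling_move H (?c A) B"
      unfolding pebbling_move_def using H
      by (intro exI[of _ "Inl v"] exI[of _ "Inl w"]) (auto simp: upd)
  qed
  have reach: "(pebbling_move H)\<^sup>*\<^sup>* (?c S) B \<longleftrightarrow> (\<exists>A. B = ?c A \<and> (pebbling_move G)\<^sup>*\<^sup>* S A)" for B
  proof
    assume "(pebbling_move H)\<^sup>*\<^sup>* (?c S) B"
    then show "\<exists>A. B = ?c A \<and> (pebbling_move G)\<^sup>*\<^sup>* S A"
    proof induction
      case (step B C)
      then obtain A where "B = ?c A" and A: "(pebbling_move G)\<^sup>*\<^sup>* S A" by blast
      with step.hyps(2) obtain A' where "C = ?c A'" "pebbling_move G A A'"
        using move by blast
      with A show ?case by (blast intro: rtranclp.rtrancl_into_rtrancl)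
    qed blast
  next
    have "(pebbling_move H)\<^sup>*\<^sup>* (?c S) (?c A)" if "(pebbling_move G)\<^sup>*\<^sup>* S A" for A
      using that
    proof induction
      case (step A A')
      from step.hyps(2) have "pebbling_move H (?c A) (?c A')"
        using move by blast
      with step.IH show ?case by (simp add: rtranclp.rtrancl_into_rtrancl)
    qed blast
    then show "\<exists>A. B = ?c A \<and> (pebbling_move G)\<^sup>*\<^sup>* S A \<Longrightarrow> (pebbling_move H)\<^sup>*\<^sup>* (?c S) B"
      by blast
  qed
  show ?thesis
  proof (rule pair_pre_digraph.equality)
    show "pverts (assignment_graph H (?c S)) = pverts (relabel ?c (assignment_graph G S))"
      using reach by (auto simp: pverts_assignment_graph)
    show "parcs (assignment_graph H (?c S)) = parcs (relabel ?c (assignment_graph G S))"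
      using reach move by (fastforce simp: parcs_assignment_graph)
  qed simp
qed

section \<open>Reorienting the assignment graph around a copy of the given graph\<close>

theorem theorem8p1:
  fixes G :: "'a pair_pre_digraph" and S\<^sub>G :: "'a \<Rightarrow> nat"
  assumes "oriented_graph G" and "finite (pverts G)"
    and "\<exists>K. induced_subgraph K (with_proj (mk_symmetric (with_proj (assignment_graph G S\<^sub>G)))) \<and>
             digraph_iso (with_proj (mk_symmetric (with_proj G))) K"
  shows "\<exists>(H :: ('a + nat) pair_pre_digraph) (S\<^sub>H :: 'a + nat \<Rightarrow> nat).
           oriented_graph H \<and> finite (pverts H) \<and>
           subgraph (with_proj (relabel Inl G)) (with_proj H) \<and>
           (\<forall>v \<in> pverts G. S\<^sub>G v = S\<^sub>H (Inl v)) \<and>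
           digraph_iso (with_proj (mk_symmetric (with_proj H)))
                       (with_proj (mk_symmetric (with_proj (assignment_graph H S\<^sub>H))))"
proof -
  interpret G: oriented_graph G by fact
  have loopfree: "pair_loopfree_digraph G" by unfold_locales
  define W where "W = assignment_graph G S\<^sub>G"
  interpret W: oriented_graph W
    unfolding W_def by (rule oriented_graph_assignment_graph[OF loopfree assms(2)])
  have wfW: "pair_wf_digraph W" by unfold_locales
  have finW: "finite (pverts W)"
    unfolding W_def by (rule finite_assignment_graph[OF loopfree assms(2)])
  define E where "E = parcs (mk_symmetric (with_proj W))"
  have E: "E = parcs W \<union> (parcs W)\<inverse>"
    by (simp add: E_def parcs_mk_symmetric_with_proj)
  have EW: "A \<in> pverts W" "B \<in> pverts W" if "(A, B) \<in> E" for A B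
    using that by (auto simp: E dest: W.wellformed')
  \<comment> \<open>The equation \<open>induced\<close> is more than an inclusion: every edge of
    \<open>W\<close> inside the image comes from \<open>G\<close>, so replacing these edges by the
    arcs of \<open>G\<close> loses none.\<close>
  from assms(3) obtain f where inj: "inj_on f (pverts G)" and fW: "f ` pverts G \<subseteq> pverts W"
    and induced: "map_prod f f ` (parcs G \<union> (parcs G)\<inverse>) =
      {e \<in> E. fst e \<in> f ` pverts G \<and> snd e \<in> f ` pverts G}"
    unfolding W_def[symmetric] E_def
    by (auto simp: parcs_mk_symmetric_with_proj elim: digraph_iso_induced_subgraphE)
  let ?I = "f ` pverts G"
  \<comment> \<open>Vertices of \<open>W\<close> are functions, while those of \<open>H\<close> must
    lie in \<open>'a + nat\<close>; \<open>g\<close> numbers the former, and \<open>p\<close> uses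
    these numbers outside the image of \<open>f\<close> and undoes \<open>f\<close> inside
    it.\<close>
  obtain g :: "('a \<Rightarrow> nat) \<Rightarrow> nat" where g: "inj_on g (pverts W)"
    using finite_imp_inj_to_nat_seg[OF finW] by blast
  define p where "p A = (if A \<in> ?I then Inl (inv_into (pverts G) f A) else Inr (g A))" for A
  have pf: "p (f v) = Inl v" if "v \<in> pverts G" for v
    using that inj by (simp add: p_def)
  have p_Inl: "A \<in> ?I" if "p A = Inl v" for A v
    using that by (auto simp: p_def split: if_splits)
  have p_inj: "inj_on p (pverts W)"
    by (rule inj_onI) (use g in \<open>auto simp: p_def inj_on_eq_iff dest: inv_into_injective split: if_splits\<close>)
  \<comment> \<open>Drawing from the symmetric \<open>E\<close> reverses those arcs of
    \<open>W\<close> that leave the image.\<close>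
  define X where "X = {(A, B) \<in> E. A \<notin> ?I \<and> B \<in> ?I}"
  define Y where "Y = {(A, B) \<in> parcs W. A \<notin> ?I \<and> B \<notin> ?I}"
  define H where "H = \<lparr>pverts = p ` pverts W,
    parcs = map_prod Inl Inl ` parcs G \<union> map_prod p p ` (X \<union> Y)\<rparr>"
  have H_verts: "pverts H = p ` pverts W"
    and H_arcs: "parcs H = map_prod Inl Inl ` parcs G \<union> map_prod p p ` (X \<union> Y)"
    by (simp_all add: H_def)
  \<comment> \<open>On the vertices of \<open>G\<close>, \<open>Inl\<close> is \<open>p\<close>
    after \<open>f\<close>. Hence all arcs of \<open>H\<close> are images under \<open>p\<close> of
    arcs between vertices of \<open>W\<close>, and orientation can be checked there.\<close>
  have G_copy: "map_prod Inl Inl ` R = map_prod p p ` map_prod f f ` R"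
    if "R \<subseteq> pverts G \<times> pverts G" for R
    unfolding image_image using that by (intro image_cong) (auto simp: pf)
  have G_arcs: "parcs G \<subseteq> pverts G \<times> pverts G"
    by (auto dest: G.wellformed')
  define Z where "Z = map_prod f f ` parcs G"
  have H_arcs': "parcs H = map_prod p p ` (Z \<union> X \<union> Y)"
    unfolding H_arcs Z_def G_copy[OF G_arcs] by (simp add: image_Un Un_assoc)
  have Z_sym: "Z \<union> Z\<inverse> = {(A, B) \<in> E. A \<in> ?I \<and> B \<in> ?I}"
  proof -
    have "Z \<union> Z\<inverse> = map_prod f f ` (parcs G \<union> (parcs G)\<inverse>)"
      by (force simp: Z_def)
    then show ?thesis by (auto simp: induced)
  qed
  have Z_opp: "(B, A) \<notin> Z" if "(A, B) \<in> Z" for A B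
    using that inj G.no_opposite_arcs
    by (auto simp: Z_def) (metis G.wellformed' inj_on_eq_iff)
  define D where "D = Z \<union> X \<union> Y"
  \<comment> \<open>Edges of \<open>W\<close> are sorted by whether both, exactly one or none of
    their ends lie in the image; \<open>Z\<close>, \<open>X\<close> and \<open>Y\<close> each orient
    one class.\<close>
  have D_sym: "D \<union> D\<inverse> = E"
  proof -
    have "X \<union> X\<inverse> = {(A, B) \<in> E. (A \<in> ?I) \<noteq> (B \<in> ?I)}"
      by (auto simp: X_def E)
    moreover have "Y \<union> Y\<inverse> = {(A, B) \<in> E. A \<notin> ?I \<and> B \<notin> ?I}"
      by (auto simp: Y_def E)
    moreover have "D \<union> D\<inverse> = (Z \<union> Z\<inverse>) \<union> (X \<union> X\<inverse>) \<union> (Y \<union> Y\<inverse>)"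
      by (auto simp: D_def)
    ultimately show ?thesis using Z_sym by auto
  qed
  have Z_I: "A \<in> ?I" "B \<in> ?I" if "(A, B) \<in> Z" for A B
    using that Z_sym by auto
  have D_opp: "(B, A) \<notin> D" if "(A, B) \<in> D" for A B
    using that Z_opp Z_I W.no_opposite_arcs unfolding D_def X_def Y_def by blast
  have D_W: "A \<in> pverts W" "B \<in> pverts W" if "(A, B) \<in> D" for A B
    using that D_sym EW by auto
  have H_relabel: "H = relabel p \<lparr>pverts = pverts W, parcs = D\<rparr>"
    by (rule pair_pre_digraph.equality) (auto simp: H_verts H_arcs' D_def)
  have H_opp: "(y, x) \<notin> parcs H" if "(x, y) \<in> parcs H" for x y
  proof
    assume "(y, x) \<in> parcs H"
    then obtain A B where 1: "(B, A) \<in> D" "x = p A" "y = p B"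
      by (auto simp: H_relabel)
    from \<open>(x, y) \<in> parcs H\<close> obtain A' B' where 2: "(A', B') \<in> D" "x = p A'" "y = p B'"
      by (auto simp: H_relabel)
    from 1 2 have "A' = A" "B' = B"
      using p_inj D_W by (metis inj_on_eq_iff)+
    with 1 2 D_opp show False by blast
  qed
  have wfH: "pair_wf_digraph H"
    using D_W unfolding H_relabel
    by (intro pair_wf_digraph_relabel) (auto simp: pair_wf_digraph_def)
  interpret H: pair_wf_digraph H by fact
  have "oriented_graph H"
    \<comment> \<open>A loop would be its own opposite arc, so \<open>H_opp\<close> excludes loops
      too.\<close>
    by unfold_locales (metis H_opp prod.collapse, rule H_opp)
  moreover have "finite (pverts H)"
    using finW by (simp add: H_verts)
  moreover have "subgraph (with_proj (relabel Inl G)) (with_proj H)"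
  proof -
    have "Inl ` pverts G \<subseteq> pverts H"
      using pf fW unfolding H_verts by (metis image_eqI image_subset_iff)
    then show ?thesis
      using wf_digraph_with_proj[OF wfH]
        wf_digraph_with_proj[OF pair_wf_digraph_relabel[OF G.pair_wf_digraph_axioms]]
      by (simp add: subgraph_def compatible_def H_arcs)
  qed
  moreover have "digraph_iso (with_proj (mk_symmetric (with_proj H)))
    (with_proj (mk_symmetric (with_proj (assignment_graph H (case_sum S\<^sub>G (\<lambda>_. 0))))))"
  proof -
    let ?c = "\<lambda>A :: 'a \<Rightarrow> nat. case_sum A (\<lambda>_ :: nat. 0 :: nat)"
    have "(Inl v, y) \<in> parcs H \<longleftrightarrow> (\<exists>w. y = Inl w \<and> (v, w) \<in> parcs G)" for v y
    proof
      assume "(Inl v, y) \<in> parcs H"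
      \<comment> \<open>Arcs from \<open>X\<close> and \<open>Y\<close> have their tail outside the
        image, where \<open>p\<close> takes values \<open>Inr\<close>.\<close>
      moreover have "(Inl v, y) \<notin> map_prod p p ` (X \<union> Y)"
      proof
        assume "(Inl v, y) \<in> map_prod p p ` (X \<union> Y)"
        then obtain e where e: "(Inl v, y) = map_prod p p e" "e \<in> X \<union> Y"
          by (rule imageE)
        from e(1) have "p (fst e) = Inl v"
          by (cases e) simp
        moreover from e(2) have "fst e \<notin> ?I"
          by (cases e) (simp add: X_def Y_def, blast)
        ultimately show False
          using p_Inl by blast
      qed
      ultimately show "\<exists>w. y = Inl w \<and> (v, w) \<in> parcs G"
        by (auto simp: H_arcs)
    next
      assume "\<exists>w. y = Inl w \<and> (v, w) \<in> parcs G"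
      then obtain w where "y = Inl w" and "(v, w) \<in> parcs G" by blast
      then have "(Inl v, y) \<in> map_prod Inl Inl ` parcs G"
        by (intro image_eqI[of _ _ "(v, w)"]) simp_all
      then show "(Inl v, y) \<in> parcs H"
        unfolding H_arcs by (rule UnI1)
    qed
    then have "assignment_graph H (?c S\<^sub>G) = relabel ?c W"
      unfolding W_def by (rule assignment_graph_extend_zero)
    then have AH: "mk_symmetric (with_proj (assignment_graph H (?c S\<^sub>G))) =
        relabel ?c (mk_symmetric (with_proj W))"
      by (simp add: mk_symmetric_relabel)
    \<comment> \<open>Symmetrising forgets the reorientation, so both underlying graphs are
      injective relabellings of that of \<open>W\<close>: by \<open>p\<close> for \<open>H\<close>,
      by \<open>?c\<close> for its assignment graph.\<close>
    have "mk_symmetric (with_proj \<lparr>pverts = pverts W, parcs = D\<rparr>) = mk_symmetric (with_proj W)"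
      by (intro pair_pre_digraph.equality) (simp_all add: parcs_mk_symmetric_with_proj D_sym E)
    then have HW: "mk_symmetric (with_proj H) = relabel p (mk_symmetric (with_proj W))"
      by (simp add: H_relabel mk_symmetric_relabel)
    note wf = pair_wf_digraph_mk_symmetric[OF wfW]
    have "inj ?c"
      by (rule injI) (auto simp: fun_eq_iff split: sum.splits)
    then have "digraph_iso (with_proj (mk_symmetric (with_proj W)))
        (with_proj (relabel ?c (mk_symmetric (with_proj W))))"
      by (intro digraph_iso_relabel[OF wf]) (auto intro: inj_on_subset)
    moreover have "digraph_iso (with_proj (relabel p (mk_symmetric (with_proj W))))
        (with_proj (mk_symmetric (with_proj W)))"
      by (rule digraph_iso_swap[OF wf_digraph_with_proj[OF wf] digraph_iso_relabel[OF wf]])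
         (simp add: p_inj)
    ultimately show ?thesis
      unfolding AH HW by (rule digraph_iso_trans[rotated])
  qed
  ultimately show ?thesis
    by (intro exI[of _ H] exI[of _ "case_sum S\<^sub>G (\<lambda>_. 0)"] conjI) simp_all
qed

end
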